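(* Let $r$, $s$ and $t$ be any integers and let $n$ be a non-negative integer. Then $$\sum_{k=0}^n \binom{n}{k} \frac{1}{k+1} (-1)^{k} F_{r+s}^{k+1} F_s^{n-k} F_{s(k+1)+(r+s)(n-k)-t} = \frac{1}{n+1}\Big( F_s^{n+1} F_{(r+s)(n+1)-t} + (-1)^{(s+1)(n+1)+t} F_t F_{r}^{n+1} \Big)$$ and $$\sum_{k=0}^n \binom{n}{k} \frac{1}{k+1} (-1)^{k} F_{r+s}^{k+1} F_s^{n-k} L_{s(k+1)+(r+s)(n-k)-t} = \frac{1}{n+1}\Big( F_s^{n+1} L_{(r+s)(n+1)-t} + (-1)^{(s+1)(n+1)+t+1} L_t F_{r}^{n+1} \Big).$$
   Context: $F_m$ and $L_m$ denote the Fibonacci and Lucas numbers, defined for all integers $m$ by the recurrence $x_m = x_{m-1}+x_{m-2}$ with $F_0=0$, $F_1=1$ and $L_0=2$, $L_1=1$. In particular $F_{-m}=(-1)^{m-1}F_m$ and $L_{-m}=(-1)^m L_m$. The convention $x^0=1$ (also for $x=0$) is used. *)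

theory Defs
  imports Complex_Main "HOL-Number_Theory.Fib"
begin

text \<open>Below 0 the recurrence is solved for the term of smallest index,
  \<open>x (m - 2) = x m - x (m - 1)\<close>.\<close>

function fib_int :: "int \<Rightarrow> int" where
  "fib_int m =
    (if m = 0 then 0 else if m = 1 then 1
     else if m > 1 then fib_int (m - 1) + fib_int (m - 2)
     else fib_int (m + 2) - fib_int (m + 1))"
  by pat_completeness auto
termination
  by (relation "measure (\<lambda>m. if m \<ge> 0 then nat m else nat (1 - m))") auto

function lucas_int :: "int \<Rightarrow> int" where
  "lucas_int m =
    (if m = 0 then 2 else if m = 1 then 1
     else if m > 1 then lucas_int (m - 1) + lucas_int (m - 2)
     else lucas_int (m + 2) - lucas_int (m + 1))"
  by pat_completeness auto
termination
  by (relation "measure (\<lambda>m. if m \<ge> 0 then nat m else nat (1 - m))") auto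

declare fib_int.simps [simp del] lucas_int.simps [simp del]

lemma fib_int_0 [simp]: "fib_int 0 = 0" and fib_int_1 [simp]: "fib_int 1 = 1"
  by (simp_all add: fib_int.simps)

lemma lucas_int_0 [simp]: "lucas_int 0 = 2" and lucas_int_1 [simp]: "lucas_int 1 = 1"
  by (simp_all add: lucas_int.simps)

lemma fib_int_rec: "fib_int m = fib_int (m - 1) + fib_int (m - 2)"
proof (cases "m > 1")
  case True
  then show ?thesis by (subst fib_int.simps) simp
next
  case False
  then have "fib_int (m - 2) = fib_int m - fib_int (m - 1)"
    by (subst fib_int.simps) (simp add: algebra_simps)
  then show ?thesis by simp
qed

lemma lucas_int_rec: "lucas_int m = lucas_int (m - 1) + lucas_int (m - 2)"
proof (cases "m > 1")
  case True
  then show ?thesis by (subst lucas_int.simps) simp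
next
  case False
  then have "lucas_int (m - 2) = lucas_int m - lucas_int (m - 1)"
    by (subst lucas_int.simps) (simp add: algebra_simps)
  then show ?thesis by simp
qed

lemma fib_int_of_nat: "fib_int (int n) = int (fib n)"
proof (induction n rule: fib.induct)
  case (3 n)
  then show ?case
    using fib_int_rec [of "int (Suc (Suc n))"] by (simp add: algebra_simps)
qed simp_all

end

theory Submission
  imports Defs
begin

text \<open>For both roots \<open>x\<close> of \<open>x\<^sup>2 = x + 1\<close> the quantity
  \<open>F\<^sub>s x\<^bsup>r+s\<^esup> - F\<^bsub>r+s\<^esub> x\<^sup>s\<close> has the same value \<open>(-1)\<^bsup>s+1\<^esup> F\<^sub>r\<close>.
  After the absorption \<open>(n choose k) / (k + 1) = (n+1 choose k+1) / (n + 1)\<close>, the sum is the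
  binomial expansion of the \<open>(n+1)\<close>-st power of this quantity, multiplied by
  \<open>- x\<^bsup>-t\<^esup> / (n + 1)\<close>, with the term that is free of \<open>F\<^bsub>r+s\<^esub>\<close> missing. Binet's formulas combine the identities for the two roots.\<close>

text \<open>Gives Binet's formulas at all integer indices at once, with no separate treatment of
  negative ones. The recurrence can be run upwards and, since the values lie in a group, downwards,
  so the values at 0 and 1 determine everything.\<close>

lemma recurrence_unique:
  fixes G H :: "int \<Rightarrow> 'a::ab_group_add"
  assumes G: "\<And>m. G m = G (m - 1) + G (m - 2)"
    and H: "\<And>m. H m = H (m - 1) + H (m - 2)"
    and init: "G 0 = H 0" "G 1 = H 1"
  shows "G m = H m"
proof -
  \<comment> \<open>The recurrence has order two, so the induction in both directions from 0 carries
    two neighbouring values.\<close>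
  have "G m = H m \<and> G (m + 1) = H (m + 1)"
  proof (induction m rule: int_induct [where k = 0])
    case base
    then show ?case using init by simp
  next
    case (step1 i)
    then show ?case using G [of "i + 2"] H [of "i + 2"] by (simp add: algebra_simps)
  next
    case (step2 i)
    then show ?case using G [of "i + 1"] H [of "i + 1"] by (simp add: algebra_simps)
  qed
  then show ?thesis ..
qed

definition golden :: real where "golden = (1 + sqrt 5) / 2"

definition golden_conj :: real where "golden_conj = (1 - sqrt 5) / 2"

lemma golden_mult_conj: "golden * golden_conj = -1"
  by (simp add: golden_def golden_conj_def field_simps)

lemma golden_nonzero: "golden \<noteq> 0" "golden_conj \<noteq> 0"
  using golden_mult_conj by auto

lemma golden_square: "golden\<^sup>2 = golden + 1" "golden_conj\<^sup>2 = golden_conj + 1"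
  by (simp_all add: golden_def golden_conj_def power2_eq_square field_simps)

lemma powi_recurrence:
  fixes x :: "'a::field"
  assumes "x\<^sup>2 = x + 1" and "x \<noteq> 0"
  shows "x powi m = x powi (m - 1) + x powi (m - 2)"
proof -
  have "x powi m = x powi (m - 2) * x\<^sup>2"
    using assms(2) power_int_add [of x "m - 2" 2] by simp
  also have "\<dots> = x powi (m - 2) * x + x powi (m - 2)"
    by (simp add: assms(1) distrib_left)
  also have "x powi (m - 2) * x = x powi (m - 1)"
    using assms(2) power_int_add_1 [of x "m - 2"] by simp
  finally show ?thesis .
qed

lemmas golden_powi_recurrence =
  powi_recurrence [OF golden_square(1) golden_nonzero(1)]
  powi_recurrence [OF golden_square(2) golden_nonzero(2)]

lemma fib_int_binet:
  "real_of_int (fib_int m) = (golden powi m - golden_conj powi m) / sqrt 5"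
proof (rule recurrence_unique)
  fix m
  show "real_of_int (fib_int m) = real_of_int (fib_int (m - 1)) + real_of_int (fib_int (m - 2))"
    by (subst fib_int_rec) simp
  show "(golden powi m - golden_conj powi m) / sqrt 5 =
      (golden powi (m - 1) - golden_conj powi (m - 1)) / sqrt 5 +
      (golden powi (m - 2) - golden_conj powi (m - 2)) / sqrt 5"
    by (simp add: golden_powi_recurrence [of m] diff_divide_distrib add_divide_distrib)
qed (simp_all add: golden_def golden_conj_def field_simps)

lemma lucas_int_binet: "real_of_int (lucas_int m) = golden powi m + golden_conj powi m"
proof (rule recurrence_unique)
  fix m
  show "real_of_int (lucas_int m) = real_of_int (lucas_int (m - 1)) + real_of_int (lucas_int (m - 2))"
    by (subst lucas_int_rec) simp
  show "golden powi m + golden_conj powi m =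
      (golden powi (m - 1) + golden_conj powi (m - 1)) +
      (golden powi (m - 2) + golden_conj powi (m - 2))"
    by (simp add: golden_powi_recurrence [of m])
qed (simp_all add: golden_def golden_conj_def field_simps)

lemma golden_powi_mult_conj: "golden powi m * golden_conj powi m = (-1) powi m"
  by (simp add: golden_mult_conj flip: power_int_mult_distrib)

text \<open>The product of the roots is -1, so the inverse of each root is minus the other
  one.\<close>

lemma golden_powi_minus:
  "golden powi (- m) = (-1) powi m * golden_conj powi m"
  "golden_conj powi (- m) = (-1) powi m * golden powi m"
proof -
  have "x powi (- m) = (-1) powi m * y powi m" if "x * y = -1" for x y :: real
  proof -
    have "inverse x = -1 * y"
      using that by (intro inverse_unique) simp
    then show ?thesis
      by (simp only: power_int_minus flip: power_int_inverse power_int_mult_distrib)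
  qed
  then show "golden powi (- m) = (-1) powi m * golden_conj powi m"
    and "golden_conj powi (- m) = (-1) powi m * golden powi m"
    using golden_mult_conj by (simp_all add: mult.commute)
qed

lemma fib_int_minus:
  "real_of_int (fib_int (- m)) = - ((-1) powi m * real_of_int (fib_int m))"
  by (simp add: fib_int_binet golden_powi_minus field_simps)

lemma lucas_int_minus:
  "real_of_int (lucas_int (- m)) = (-1) powi m * real_of_int (lucas_int m)"
  by (simp add: lucas_int_binet golden_powi_minus field_simps)

text \<open>Write \<alpha>, \<beta> for the roots. After substituting Binet's formula for
  \<open>fib_int s\<close> and \<open>fib_int (r + s)\<close>, the powers of the single root
  \<open>x\<close> with exponent \<open>r + 2 * s\<close> cancel. For either choice of
  \<open>x\<close> the rest is -(\<alpha>\<beta>)^s (\<alpha>^r - \<beta>^r) / sqrt 5.\<close>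

lemma fib_int_golden_powi:
  fixes r s :: int
  assumes "x = golden \<or> x = golden_conj"
  shows "real_of_int (fib_int s) * x powi (r + s) - real_of_int (fib_int (r + s)) * x powi s =
    (-1) powi (s + 1) * real_of_int (fib_int r)"
proof -
  \<comment> \<open>With the sign written through powers of the roots, the claim becomes a field
    identity in these powers.\<close>
  have "(-1) powi (s + 1) = - (golden powi s * golden_conj powi s)"
    by (simp add: power_int_add golden_powi_mult_conj)
  then show ?thesis
    using assms golden_nonzero
    by (auto simp: fib_int_binet power_int_add field_simps)
qed

text \<open>Absorption turns the summand into the term of index \<open>k + 1\<close> in the
  expansion of \<open>(X + Y) ^ (n + 1)\<close>, up to the factor \<open>1 / (n + 1)\<close>. Only
  the term of index 0 is missing, which is the subtracted \<open>Y ^ (n + 1)\<close>.\<close>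

lemma binomial_sum_absorb:
  fixes X Y :: real
  shows "(\<Sum>k=0..n. real (n choose k) * (1 / (real k + 1)) * X ^ (k + 1) * Y ^ (n - k)) =
    ((X + Y) ^ (n + 1) - Y ^ (n + 1)) / (real n + 1)"
proof -
  have absorb: "real (n choose k) * (1 / (real k + 1)) = real (Suc n choose Suc k) / (real n + 1)" for k
  proof -
    have "real (Suc k) * real (Suc n choose Suc k) = real (Suc n) * real (n choose k)"
      by (metis Suc_times_binomial of_nat_mult)
    then show ?thesis by (simp add: field_simps del: binomial_Suc_Suc)
  qed
  have "(X + Y) ^ (n + 1) = (\<Sum>j\<le>Suc n. real (Suc n choose j) * X ^ j * Y ^ (Suc n - j))"
    using binomial_ring [of X Y "Suc n"] by simp
  also have "\<dots> = Y ^ (n + 1) +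
      (\<Sum>k\<le>n. real (Suc n choose Suc k) * X ^ Suc k * Y ^ (n - k))"
    by (subst sum.atMost_Suc_shift) simp
  finally show ?thesis
    by (simp only: absorb) (simp add: sum_divide_distrib atLeast0AtMost del: binomial_Suc_Suc)
qed

text \<open>To be used with \<open>a\<close>, \<open>b\<close> the Fibonacci numbers at
  \<open>r + s\<close> and \<open>s\<close>, with \<open>p = s\<close>, \<open>q = r + s\<close>,
  and \<open>x\<close> either root. Then \<open>c\<close> is the common value from
  \<open>fib_int_golden_powi\<close>.\<close>

lemma binomial_sum_powi:
  fixes x a b c :: real and p q t :: int
  assumes x: "x \<noteq> 0" and c: "b * x powi q - a * x powi p = c"
  shows "(\<Sum>k=0..n. real (n choose k) * (1 / (real k + 1)) * (-1) ^ k * a ^ (k + 1) * b ^ (n - k)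
            * x powi (p * (int k + 1) + q * (int n - int k) - t)) =
    1 / (real n + 1) * (b ^ (n + 1) * x powi (q * (int n + 1) - t) - c ^ (n + 1) * x powi (- t))"
proof -
  \<comment> \<open>The alternating sign goes into \<open>X\<close>. Since \<open>(-1) ^ k\<close>
    is paired with the exponent \<open>k + 1\<close>, one minus sign is left over in front of every
    summand.\<close>
  define X Y where "X = - (a * x powi p)" and "Y = b * x powi q"
  have powi_mult_nat: "x powi (m * int j) = (x powi m) ^ j" for m j
    by (simp add: power_int_mult)
  have "(\<Sum>k=0..n. real (n choose k) * (1 / (real k + 1)) * (-1) ^ k * a ^ (k + 1) * b ^ (n - k)
            * x powi (p * (int k + 1) + q * (int n - int k) - t)) =
    (\<Sum>k=0..n. - (real (n choose k) * (1 / (real k + 1)) * X ^ (k + 1) * Y ^ (n - k)) * x powi (- t))"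
  proof (rule sum.cong)
    fix k assume "k \<in> {0..n}"
    then have "p * (int k + 1) + q * (int n - int k) - t = p * int (k + 1) + q * int (n - k) + - t"
      by (simp add: of_nat_diff)
    then have "x powi (p * (int k + 1) + q * (int n - int k) - t) =
        (x powi p) ^ (k + 1) * (x powi q) ^ (n - k) * x powi (- t)"
      by (simp only: power_int_add [OF disjI1 [OF x]] powi_mult_nat)
    moreover have "X ^ (k + 1) = - ((-1) ^ k * a ^ (k + 1) * (x powi p) ^ (k + 1))"
      unfolding X_def by (subst power_minus) (simp add: power_mult_distrib)
    ultimately show "real (n choose k) * (1 / (real k + 1)) * (-1) ^ k * a ^ (k + 1) * b ^ (n - k)
            * x powi (p * (int k + 1) + q * (int n - int k) - t) =
        - (real (n choose k) * (1 / (real k + 1)) * X ^ (k + 1) * Y ^ (n - k)) * x powi (- t)"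
      by (simp only: Y_def power_mult_distrib) (simp only: mult_minus_left mult_minus_right minus_minus mult_ac)
  qed simp
  also have "\<dots> = - (((X + Y) ^ (n + 1) - Y ^ (n + 1)) / (real n + 1)) * x powi (- t)"
    by (simp only: sum_distrib_right [symmetric] sum_negf binomial_sum_absorb)
  also have "X + Y = c"
    using c by (simp add: X_def Y_def)
  also have "- ((c ^ (n + 1) - Y ^ (n + 1)) / (real n + 1)) * x powi (- t) =
      1 / (real n + 1) * (Y ^ (n + 1) * x powi (- t) - c ^ (n + 1) * x powi (- t))"
    by (simp add: field_simps)
  also have "Y ^ (n + 1) * x powi (- t) = b ^ (n + 1) * x powi (q * (int n + 1) - t)"
    using powi_mult_nat [of q "n + 1"] power_int_add [OF disjI1 [OF x], of "q * (int n + 1)" "- t"]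
    by (simp add: Y_def power_mult_distrib add.commute)
  finally show ?thesis .
qed

text \<open>Both sides are linear in \<open>G\<close>, so it is enough to combine the identities for
  the two roots with weights \<open>u\<close> and \<open>v\<close>. Because \<open>c\<close> is the
  same for both roots, the powers with exponent \<open>- t\<close> recombine to
  \<open>G (- t)\<close>. Fibonacci and Lucas numbers differ only in the weights.\<close>

lemma binomial_sum_fib_int:
  fixes r s t :: int and u v :: real
  assumes G: "\<And>m. G m = u * golden powi m + v * golden_conj powi m"
  shows "(\<Sum>k=0..n. real (n choose k) * (1 / (real k + 1)) * (-1) ^ k
            * real_of_int (fib_int (r + s)) ^ (k + 1) * real_of_int (fib_int s) ^ (n - k)
            * G (s * (int k + 1) + (r + s) * (int n - int k) - t)) =
    1 / (real n + 1) *
       (real_of_int (fib_int s) ^ (n + 1) * G ((r + s) * (int n + 1) - t)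
        - ((-1) powi (s + 1) * real_of_int (fib_int r)) ^ (n + 1) * G (- t))"
proof -
  define S where "S x = (\<Sum>k=0..n. real (n choose k) * (1 / (real k + 1)) * (-1) ^ k
            * real_of_int (fib_int (r + s)) ^ (k + 1) * real_of_int (fib_int s) ^ (n - k)
            * x powi (s * (int k + 1) + (r + s) * (int n - int k) - t))" for x :: real
  have S: "S x = 1 / (real n + 1) *
       (real_of_int (fib_int s) ^ (n + 1) * x powi ((r + s) * (int n + 1) - t)
        - ((-1) powi (s + 1) * real_of_int (fib_int r)) ^ (n + 1) * x powi (- t))"
    if "x = golden \<or> x = golden_conj" for x
    unfolding S_def
    by (rule binomial_sum_powi) (use that golden_nonzero fib_int_golden_powi in auto)
  have "(\<Sum>k=0..n. real (n choose k) * (1 / (real k + 1)) * (-1) ^ k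
            * real_of_int (fib_int (r + s)) ^ (k + 1) * real_of_int (fib_int s) ^ (n - k)
            * G (s * (int k + 1) + (r + s) * (int n - int k) - t)) =
        u * S golden + v * S golden_conj"
    unfolding S_def G sum_distrib_left sum.distrib [symmetric]
    by (rule sum.cong) (simp_all only: distrib_left mult_ac)
  also have "\<dots> = 1 / (real n + 1) *
       (real_of_int (fib_int s) ^ (n + 1) * G ((r + s) * (int n + 1) - t)
        - ((-1) powi (s + 1) * real_of_int (fib_int r)) ^ (n + 1) * G (- t))"
    by (simp only: S simp_thms G distrib_left right_diff_distrib mult_ac) (simp only: algebra_simps)
  finally show ?thesis .
qed

theorem theorem11:
  fixes r s t :: int and n :: nat
  shows "((\<Sum>k=0..n. real (n choose k) * (1 / (real k + 1)) * (-1) ^ k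
            * real_of_int (fib_int (r + s)) ^ (k + 1) * real_of_int (fib_int s) ^ (n - k)
            * real_of_int (fib_int (s * (int k + 1) + (r + s) * (int n - int k) - t)))
         = 1 / (real n + 1) *
            (real_of_int (fib_int s) ^ (n + 1)
               * real_of_int (fib_int ((r + s) * (int n + 1) - t))
             + (-1) powi ((s + 1) * (int n + 1) + t)
               * real_of_int (fib_int t) * real_of_int (fib_int r) ^ (n + 1)))
     \<and> ((\<Sum>k=0..n. real (n choose k) * (1 / (real k + 1)) * (-1) ^ k
            * real_of_int (fib_int (r + s)) ^ (k + 1) * real_of_int (fib_int s) ^ (n - k)
            * real_of_int (lucas_int (s * (int k + 1) + (r + s) * (int n - int k) - t)))
         = 1 / (real n + 1) *
            (real_of_int (fib_int s) ^ (n + 1)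
               * real_of_int (lucas_int ((r + s) * (int n + 1) - t))
             + (-1) powi ((s + 1) * (int n + 1) + t + 1)
               * real_of_int (lucas_int t) * real_of_int (fib_int r) ^ (n + 1)))"
proof -
  have sign: "((-1) powi (s + 1) * y) ^ (n + 1) = (-1) powi ((s + 1) * (int n + 1)) * y ^ (n + 1)"
    for y :: real
  proof -
    have "(-1 :: real) powi ((s + 1) * (int n + 1)) = ((-1) powi (s + 1)) powi int (n + 1)"
      by (simp add: power_int_mult add.commute)
    then show ?thesis
      by (simp only: power_mult_distrib power_int_of_nat)
  qed
  have pow: "(-1 :: real) powi (m + k) = (-1) powi m * (-1) powi k" for m k
    by (simp add: power_int_add)
  have fib: "real_of_int (fib_int m) = (1 / sqrt 5) * golden powi m + (- 1 / sqrt 5) * golden_conj powi m"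
    and lucas: "real_of_int (lucas_int m) = 1 * golden powi m + 1 * golden_conj powi m" for m
    by (simp_all add: fib_int_binet lucas_int_binet diff_divide_distrib)
  \<comment> \<open>The reflection formulas replace \<open>G (- t)\<close>. The Fibonacci one
    contributes an extra minus sign that cancels the one in front of this term; in the Lucas case
    that sign stays and becomes the additional 1 in the exponent of -1.\<close>
  show ?thesis
    unfolding binomial_sum_fib_int [where G = "\<lambda>m. real_of_int (fib_int m)", OF fib]
      binomial_sum_fib_int [where G = "\<lambda>m. real_of_int (lucas_int m)", OF lucas]
      sign fib_int_minus lucas_int_minus pow [of _ t] pow [of "_ + t" 1]
    by simp
qed

end
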